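(* Let $F:\mathbb{R}^{\underline{m}}\to\mathbb{R}^{\overline{m}}$ be linear with trivial nullspace, let $\mathbf{x}_1,\ldots,\mathbf{x}_N\in\mathbb{R}^{\underline{m}}$ be linearly independent, let $\overline{\mathbf{x}}_1,\ldots,\overline{\mathbf{x}}_N$ be their Gram-Schmidt orthonormalization, $\overline{\mathbf{y}}_i=F\overline{\mathbf{x}}_i$, $\overline{\mathbf{Y}}=(\overline{\mathbf{y}}_1,\ldots,\overline{\mathbf{y}}_N)$, and $A=\overline{\mathbf{Y}}\,\overline{\mathbf{Y}}^T$. Let $\psi_1,\ldots,\psi_N$ be orthonormal eigenvectors of $A$ belonging to its non-zero eigenvalues, where for each $l$ the index $k(l)$ is such that $\psi_l\in E^{k(l)}$, and write $$\psi_l=\sum_{j=1}^{m(l)}\nu_j\,\mathbf{v}^{l(j)},$$ where $m(l)=\dim E^{k(l)}$, $\mathbf{v}^{l(1)},\ldots,\mathbf{v}^{l(m(l))}$ are the left singular vectors of $F$ spanning $E^{k(l)}$, and the coefficients $\nu_j=\nu_j(l)\in\mathbb{R}$ depend on $l$. For $\mathbf{y}\in\mathbb{R}^{\overline{m}}$ let $\mathbf{y}_{ls}=\sum_{l=1}^N\langle\mathbf{y},\psi_l\rangle\psi_l$. Then the minimum norm solution $\mathbf{x}_{ls}$ of $F\mathbf{x}_{ls}=\mathbf{y}_{ls}$ is given by $$\mathbf{x}_{ls}=\sum_{l=1}^N\langle\mathbf{y},\psi_l\rangle\left(\frac{1}{\hat\gamma^{k(l)}}\sum_{j=1}^{m(l)}\nu_j\,\mathbf{u}^{l(j)}\right)=\sum_{l=1}^N\frac{\langle\mathbf{y},\psi_l\rangle}{(\hat\gamma^{k(l)})^2}\,F^*\left(\sum_{j=1}^{m(l)}\nu_j\,\mathbf{v}^{l(j)}\right)=\sum_{l=1}^N\frac{\langle\mathbf{y},\psi_l\rangle}{(\hat\gamma^{k(l)})^2}\,F^*\psi_l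 .$$
   Context: Singular value decomposition: for every $\mathbf{x}\in\mathbb{R}^{\underline{m}}$, $$F\mathbf{x}=\sum_{j=1}^{\min\{\underline{m},\overline{m}\}}\gamma^j\langle\mathbf{x},\mathbf{u}^j\rangle\mathbf{v}^j,\qquad F^T\mathbf{v}^j=\gamma^j\mathbf{u}^j,\qquad F\mathbf{u}^j=\gamma^j\mathbf{v}^j,$$ where $\mathbf{u}^j\in\mathbb{R}^{\underline{m}}$, $j=1,\ldots,\underline{m}$, are orthonormal, $\mathbf{v}^j\in\mathbb{R}^{\overline{m}}$, $j=1,\ldots,\overline{m}$, are orthonormal, and $0\le\gamma^1\le\cdots\le\gamma^{\min\{\underline{m},\overline{m}\}}$. Since $F$ has trivial nullspace, $\gamma^j>0$ for all $j\le\min\{\underline{m},\overline{m}\}$. The distinct singular values are $\{\hat\gamma^k:k=1,\ldots,\hat m\}$, and $$E^k:=\operatorname{span}\{\mathbf{v}^j:\gamma^j=\hat\gamma^k,\ j=1,\ldots,\min\{\underline{m},\overline{m}\}\}.$$ For each $l$, $l(1),\ldots,l(m(l))$ denote the indices $j\in\{1,\ldots,\min\{\underline{m},\overline{m}\}\}$ with $\gamma^j=\hat\gamma^{k(l)}$, and $\mathbf{u}^{l(j)}$ is the right singular vector paired with $\mathbf{v}^{l(j)}$. $F^*=F^T$ is the adjoint. Gram-Schmidt: $\overline{\mathbf{x}}_j=\rho(\mathbf{x}_j)/\|\rho(\mathbf{x}_j)\|$ with $\rho(\mathbf{x}_j)=\mathbf{x}_j-\sum_{i=1}^{j-1}\langle\mathbf{x}_j,\overline{\mathbf{x}}_i\rangle\overline{\mathbf{x}}_i$,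 $j=1,\ldots,N$. Standing assumptions: $\mathbf{x}_1,\ldots,\mathbf{x}_N$ are linearly independent and $F$ has trivial nullspace; hence $N\le\min\{\underline{m},\overline{m}\}$ and $A$ has rank $N$. *)

theory Defs
  imports "HOL-Analysis.Analysis"
begin

(* Families of vectors are functions on nat, used at the indices 1, ..., n. *)

definition orthonormal_family :: "nat \<Rightarrow> (nat \<Rightarrow> 'a::real_inner) \<Rightarrow> bool" where
  "orthonormal_family n b \<longleftrightarrow>
     (\<forall>i\<in>{1..n}. \<forall>j\<in>{1..n}. b i \<bullet> b j = (if i = j then 1 else 0))"

(* Independence of a family also excludes repetitions, which independence of its range does not. *)
definition independent_family :: "nat \<Rightarrow> (nat \<Rightarrow> 'a::real_vector) \<Rightarrow> bool" where
  "independent_family n x \<longleftrightarrow> inj_on x {1..n} \<and> independent (x ` {1..n})"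

fun gram_schmidt :: "(nat \<Rightarrow> 'a::real_inner) \<Rightarrow> nat \<Rightarrow> 'a" where
  "gram_schmidt x j =
     (let \<rho> = x j - (\<Sum>i\<in>{1..<j}. (x j \<bullet> gram_schmidt x i) *\<^sub>R gram_schmidt x i)
      in (1 / norm \<rho>) *\<^sub>R \<rho>)"

(* The equation unfolds without end as a simp rule. *)
declare gram_schmidt.simps [simp del]

(* The product of the matrix with columns y 1, ..., y N and its transpose, written out
   entrywise because the number N of columns is not the cardinality of an index type. *)
definition mult_transpose :: "nat \<Rightarrow> (nat \<Rightarrow> real^'m) \<Rightarrow> real^'m^'m" where
  "mult_transpose N y = (\<chi> p q. \<Sum>i=1..N. y i $ p * y i $ q)"

definition eigenvector :: "real^'m^'m \<Rightarrow> real \<Rightarrow> real^'m \<Rightarrow> bool" where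
  "eigenvector A \<mu> w \<longleftrightarrow> w \<noteq> 0 \<and> A *v w = \<mu> *\<^sub>R w"

(* Right singular vectors u, left singular vectors v, singular values \<gamma> in increasing order. *)
definition is_svd ::
  "(real^'n \<Rightarrow> real^'m) \<Rightarrow> (nat \<Rightarrow> real^'n) \<Rightarrow> (nat \<Rightarrow> real^'m) \<Rightarrow> (nat \<Rightarrow> real) \<Rightarrow> bool" where
  "is_svd F u v \<gamma> \<longleftrightarrow>
     orthonormal_family CARD('n) u \<and>
     orthonormal_family CARD('m) v \<and>
     (\<forall>j\<in>{1..min CARD('n) CARD('m)}. 0 \<le> \<gamma> j) \<and>
     mono_on {1..min CARD('n) CARD('m)} \<gamma> \<and>
     (\<forall>x. F x = (\<Sum>j=1..min CARD('n) CARD('m). (\<gamma> j * (x \<bullet> u j)) *\<^sub>R v j)) \<and>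
     (\<forall>j\<in>{1..min CARD('n) CARD('m)}. adjoint F (v j) = \<gamma> j *\<^sub>R u j) \<and>
     (\<forall>j\<in>{1..min CARD('n) CARD('m)}. F (u j) = \<gamma> j *\<^sub>R v j)"

definition min_norm_solution ::
  "('a::real_normed_vector \<Rightarrow> 'b) \<Rightarrow> 'b \<Rightarrow> 'a \<Rightarrow> bool" where
  "min_norm_solution F y x \<longleftrightarrow> is_arg_min norm (\<lambda>z. F z = y) x"

end

theory Submission
  imports Defs
begin

text \<open>A trivial nullspace makes F injective, so \<open>F x = y_ls\<close> has at most one
  solution and minimality of the norm is automatic (\<open>min_norm_solution_inj_iff\<close>); it
  suffices to exhibit one solution. Each \<psi>_l lies in the span of left singular vectors that all
  share the singular value g = \<gamma>hat(k(l)). On such a block F and its adjoint act as g times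
  the exchange of u^j and v^j. Hence the vector a_l, with the coefficients of \<psi>_l but with u^j
  in place of v^j, satisfies F a_l = g \<psi>_l and F^* \<psi>_l = g a_l
  (\<open>linear_sum_scaled\<close>, applied to both maps). As g is nonzero
  (\<open>is_svd_singular_value_nonzero\<close>), a_l / g is the preimage of \<psi>_l and equals F^*
  \<psi>_l / g^2; linearity gives the three formulas.\<close>

lemma min_norm_solution_inj_iff:
  assumes "inj F"
  shows "min_norm_solution F y x \<longleftrightarrow> F x = y"
  using injD[OF assms] by (auto simp: min_norm_solution_def is_arg_min_def)

lemma linear_sum_scaled:
  assumes "linear G" and "\<And>j. j \<in> J \<Longrightarrow> G (p j) = g *\<^sub>R q j"
  shows "G (\<Sum>j\<in>J. c j *\<^sub>R p j) = g *\<^sub>R (\<Sum>j\<in>J. c j *\<^sub>R q j)"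
  using assms
  by (simp add: linear_sum linear_scale scaleR_sum_right mult.commute)

text \<open>A zero singular value would put the unit vector \<open>u j\<close> into the nullspace of
  \<open>F\<close>.\<close>

lemma is_svd_singular_value_nonzero:
  fixes F :: "real^'n \<Rightarrow> real^'m"
  assumes "is_svd F u v \<gamma>" and "\<forall>z. F z = 0 \<longrightarrow> z = 0"
    and "j \<in> {1..min CARD('n) CARD('m)}"
  shows "\<gamma> j \<noteq> 0"
proof
  assume "\<gamma> j = 0"
  moreover have "F (u j) = \<gamma> j *\<^sub>R v j" and "u j \<bullet> u j = 1"
    using assms by (auto simp: is_svd_def orthonormal_family_def)
  ultimately show False
    using assms(2) by force
qed

theorem lemma3p1:
  fixes F :: "real^'n \<Rightarrow> real^'m"
    and u :: "nat \<Rightarrow> real^'n" and v :: "nat \<Rightarrow> real^'m" and \<gamma> :: "nat \<Rightarrow> real"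
    and r mhat N :: nat and \<gamma>hat :: "nat \<Rightarrow> real" and E :: "nat \<Rightarrow> (real^'m) set"
    and x xbar :: "nat \<Rightarrow> real^'n" and ybar :: "nat \<Rightarrow> real^'m" and A :: "real^'m^'m"
    and \<psi> :: "nat \<Rightarrow> real^'m" and k m :: "nat \<Rightarrow> nat" and idx :: "nat \<Rightarrow> nat \<Rightarrow> nat"
    and \<nu> :: "nat \<Rightarrow> nat \<Rightarrow> real" and y y_ls :: "real^'m"
  assumes "linear F" and "\<forall>z. F z = 0 \<longrightarrow> z = 0"
    and "is_svd F u v \<gamma>"
    and "r = min CARD('n) CARD('m)"
    and "bij_betw \<gamma>hat {1..mhat} (\<gamma> ` {1..r})"
    and "\<forall>i\<in>{1..mhat}. E i = span {v j |j. j \<in> {1..r} \<and> \<gamma> j = \<gamma>hat i}"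
    and "independent_family N x"
    and "\<forall>i\<in>{1..N}. xbar i = gram_schmidt x i"
    and "\<forall>i\<in>{1..N}. ybar i = F (xbar i)"
    and "A = mult_transpose N ybar"
    and "orthonormal_family N \<psi>"
    and "\<forall>l\<in>{1..N}. \<exists>\<mu>. \<mu> \<noteq> 0 \<and> eigenvector A \<mu> (\<psi> l)"
    and "\<forall>l\<in>{1..N}. k l \<in> {1..mhat} \<and> \<psi> l \<in> E (k l)"
    and "\<forall>l\<in>{1..N}. m l = dim (E (k l))"
    and "\<forall>l\<in>{1..N}. bij_betw (idx l) {1..m l} {j \<in> {1..r}. \<gamma> j = \<gamma>hat (k l)}"
    and "\<forall>l\<in>{1..N}. \<psi> l = (\<Sum>j=1..m l. \<nu> l j *\<^sub>R v (idx l j))"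
    and "y_ls = (\<Sum>l=1..N. (y \<bullet> \<psi> l) *\<^sub>R \<psi> l)"
  shows "(\<exists>!x_ls. min_norm_solution F y_ls x_ls) \<and>
    (\<forall>x_ls. min_norm_solution F y_ls x_ls \<longrightarrow>
       x_ls = (\<Sum>l=1..N. (y \<bullet> \<psi> l) *\<^sub>R
                 ((1 / \<gamma>hat (k l)) *\<^sub>R (\<Sum>j=1..m l. \<nu> l j *\<^sub>R u (idx l j)))) \<and>
       x_ls = (\<Sum>l=1..N. ((y \<bullet> \<psi> l) / (\<gamma>hat (k l))\<^sup>2) *\<^sub>R
                 adjoint F (\<Sum>j=1..m l. \<nu> l j *\<^sub>R v (idx l j))) \<and>
       x_ls = (\<Sum>l=1..N. ((y \<bullet> \<psi> l) / (\<gamma>hat (k l))\<^sup>2) *\<^sub>R adjoint F (\<psi> l)))"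
proof -
  \<comment> \<open>The right singular counterpart of \<open>\<psi> l\<close>: same coefficients,
    each left singular vector replaced by its partner.\<close>
  define a where "a l = (\<Sum>j=1..m l. \<nu> l j *\<^sub>R u (idx l j))" for l
  define z where "z = (\<Sum>l=1..N. (y \<bullet> \<psi> l) *\<^sub>R ((1 / \<gamma>hat (k l)) *\<^sub>R a l))"
  have \<psi>: "\<psi> l = (\<Sum>j=1..m l. \<nu> l j *\<^sub>R v (idx l j))" if "l \<in> {1..N}" for l
    using assms(16) that by blast
  have nz: "\<gamma>hat (k l) \<noteq> 0" if "l \<in> {1..N}" for l
  proof -
    \<comment> \<open>\<open>\<gamma>hat\<close> enumerates the values of \<open>\<gamma>\<close>,
      so \<open>\<gamma>hat (k l)\<close> is some \<open>\<gamma> j\<close> with \<open>j\<close> in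
      range.\<close>
    have "\<gamma>hat (k l) \<in> \<gamma> ` {1..r}"
      using assms(5,13) that by (auto simp: bij_betw_def)
    then show ?thesis
      using is_svd_singular_value_nonzero[OF assms(3,2)] assms(4) by auto
  qed
  have idx: "idx l j \<in> {1..r}" "\<gamma> (idx l j) = \<gamma>hat (k l)"
    if "l \<in> {1..N}" "j \<in> {1..m l}" for l j
    using assms(15) that by (fastforce dest: bij_betwE)+
  have svd: "F (u j) = \<gamma> j *\<^sub>R v j" "adjoint F (v j) = \<gamma> j *\<^sub>R u j" if "j \<in> {1..r}" for j
    using assms(3) that unfolding is_svd_def assms(4) by blast+
  \<comment> \<open>The singular value is constant on the block indexed by \<open>idx l\<close>, so
    it factors out of the sum.\<close>
  have Fa: "F (a l) = \<gamma>hat (k l) *\<^sub>R \<psi> l" if l: "l \<in> {1..N}" for l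
    unfolding a_def \<psi>[OF l]
  proof (rule linear_sum_scaled[OF assms(1)])
    fix j assume "j \<in> {1..m l}"
    then show "F (u (idx l j)) = \<gamma>hat (k l) *\<^sub>R v (idx l j)"
      using svd idx[OF l] by metis
  qed
  have Fadj: "adjoint F (\<psi> l) = \<gamma>hat (k l) *\<^sub>R a l" if l: "l \<in> {1..N}" for l
    unfolding a_def \<psi>[OF l]
  proof (rule linear_sum_scaled[OF adjoint_linear[OF assms(1)]])
    fix j assume "j \<in> {1..m l}"
    then show "adjoint F (v (idx l j)) = \<gamma>hat (k l) *\<^sub>R u (idx l j)"
      using svd idx[OF l] by metis
  qed
  have "F z = y_ls"
    using nz Fa assms(1,17) by (simp add: z_def linear_sum linear_scale)
  moreover have "inj F"
    using assms(1,2) linear_injective_0 by blast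
  \<comment> \<open>This equivalence yields existence and uniqueness together, and reduces the three
    formulas to identities for \<open>z\<close>.\<close>
  ultimately have sol: "min_norm_solution F y_ls w \<longleftrightarrow> w = z" for w
    by (auto simp: min_norm_solution_inj_iff dest: injD)
  \<comment> \<open>By \<open>Fadj\<close>, replacing \<open>a l\<close> by the adjoint image of
    \<open>\<psi> l\<close> costs one more division by \<open>\<gamma>hat (k l)\<close>, hence the
    square.\<close>
  have z_adj: "z = (\<Sum>l=1..N. ((y \<bullet> \<psi> l) / (\<gamma>hat (k l))\<^sup>2) *\<^sub>R adjoint F (\<psi> l))"
    unfolding z_def using nz Fadj
    by (intro sum.cong) (auto simp: power2_eq_square)
  then have "z = (\<Sum>l=1..N. ((y \<bullet> \<psi> l) / (\<gamma>hat (k l))\<^sup>2) *\<^sub>R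
      adjoint F (\<Sum>j=1..m l. \<nu> l j *\<^sub>R v (idx l j)))"
    using \<psi> by simp
  with z_adj show ?thesis
    unfolding sol using z_def[unfolded a_def] by blast
qed

end
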